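(* Let $A$ be an invertible Hermitian $n\times n$ complex matrix with eigendecomposition $A=U\Lambda U^\dagger$, where $U$ is unitary and $\Lambda$ is real diagonal. Then the derivative of the trace norm with respect to the Hermitian argument $A$ is $$D_A\|A\|_1=\mathrm{vec}^T\!\left[A^T\left(|A|^{-1}\right)^T\right]=\mathrm{vec}^T\!\left[A|A|^{-1}\right]K=\mathrm{vec}^T\!\left(U^*\,\mathrm{sign}(\Lambda)\,U^T\right).$$
   Context: For a matrix $X$, $X^*$ is the entrywise complex conjugate, $X^\dagger=(X^* )^T$, $|X|=\sqrt{X^\dagger X}$, and $\|X\|_1=\mathrm{Tr}|X|$ is the trace norm. $\mathrm{vec}\,X$ is the column vector obtained by stacking the columns of $X$, and $\mathrm{vec}^TX=(\mathrm{vec}\,X)^T$. For real diagonal $\Lambda$, $\mathrm{sign}(\Lambda)$ is the diagonal matrix of the signs of its entries. $K$ is the $n^2\times n^2$ commutation matrix, $K=\sum_{i,j=1}^nJ_n^{ji}\otimes J_n^{ij}$ with $(J_n^{ij})_{kl}=\delta_{ik}\delta_{jl}$, so that $\mathrm{vec}\,X^T=K\,\mathrm{vec}\,X$. Unpatterned derivatives: for a (real-)differentiable scalar function $g$ of a complex $n\times n$ matrix $X$ with independent entries, the row vectors $D_Xg$ and $D_{X^*}g$ are the unique ones such that $dg=(D_Xg)\,d\,\mathrm{vec}X+(D_{X^*}g)\,d\,\mathrm{vec}X^*$ (i.e. the vectors of Wirtinger derivatives with respect to the entries of $X$ and of $X^*$). Derivative with respect to a Hermitian argument: for Hermitian $A$,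 $D_Ag:=(D_Xg)|_{X=A}+(D_{X^*}g)|_{X=A}\,K$. Here $D_A\|A\|_1$ denotes this derivative for $g(X)=\|X\|_1$, which is differentiable at invertible $X$. *)

theory Defs
  imports "HOL-Analysis.Analysis"
begin

definition conj_mat :: "complex^'n^'m \<Rightarrow> complex^'n^'m" where
  "conj_mat X = map_matrix cnj X"

definition dagger :: "complex^'n^'m \<Rightarrow> complex^'m^'n" where
  "dagger X = transpose (conj_mat X)"

definition hermitian :: "complex^'n^'n \<Rightarrow> bool" where
  "hermitian X \<longleftrightarrow> dagger X = X"

definition unitary :: "complex^'n^'n \<Rightarrow> bool" where
  "unitary X \<longleftrightarrow> dagger X ** X = mat 1 \<and> X ** dagger X = mat 1"

definition pos_semidef :: "complex^'n^'n \<Rightarrow> bool" where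
  "pos_semidef X \<longleftrightarrow> hermitian X \<and>
     (\<forall>v. 0 \<le> Re (\<Sum>i\<in>UNIV. cnj (v $ i) * (X *v v) $ i))"

text \<open>The principal square root; a positive semidefinite matrix has exactly one positive
  semidefinite square root, so the description is proper on such arguments.\<close>

definition sqrt_mat :: "complex^'n^'n \<Rightarrow> complex^'n^'n" where
  "sqrt_mat X = (THE P. pos_semidef P \<and> P ** P = X)"

definition abs_mat :: "complex^'n^'n \<Rightarrow> complex^'n^'n" where
  "abs_mat X = sqrt_mat (dagger X ** X)"

text \<open>The trace of \<open>abs_mat X\<close> is real; it is kept as a complex number because
  the derivatives below are taken of complex-valued scalar functions.\<close>

definition trace_norm :: "complex^'n^'n \<Rightarrow> complex" where
  "trace_norm X = trace (abs_mat X)"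

definition real_diagonal :: "complex^'n^'n \<Rightarrow> bool" where
  "real_diagonal L \<longleftrightarrow> (\<forall>i j. i \<noteq> j \<longrightarrow> L $ i $ j = 0) \<and> (\<forall>i. L $ i $ i \<in> \<real>)"

definition sign_mat :: "complex^'n^'n \<Rightarrow> complex^'n^'n" where
  "sign_mat L = (\<chi> i j. if i = j then of_real (sgn (Re (L $ i $ i))) else 0)"

text \<open>The \<open>n\<^sup>2\<close> positions of vectorised matrices are indexed by pairs. The first component is the
  major one, so for stacked columns it is the column of the matrix and the second one is the row;
  the Kronecker product uses the same convention, its first component selecting the block.\<close>

definition vec_mat :: "complex^'n^'n \<Rightarrow> complex^('n \<times> 'n)" where
  "vec_mat X = (\<chi> p. X $ snd p $ fst p)"

definition vecT :: "complex^'n^'n \<Rightarrow> complex^('n \<times> 'n)^1" where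
  "vecT X = rowvector (vec_mat X)"

definition kron :: "complex^'n^'n \<Rightarrow> complex^'n^'n \<Rightarrow> complex^('n \<times> 'n)^('n \<times> 'n)" where
  "kron X Y = (\<chi> p q. X $ fst p $ fst q * Y $ snd p $ snd q)"

definition unit_mat :: "'n \<Rightarrow> 'n \<Rightarrow> complex^'n^'n" where
  "unit_mat i j = (\<chi> k l. if i = k \<and> j = l then 1 else 0)"

definition commutation_mat :: "complex^('n::finite \<times> 'n)^('n \<times> 'n)" where
  "commutation_mat = (\<Sum>i\<in>UNIV. \<Sum>j\<in>UNIV. kron (unit_mat j i) (unit_mat i j))"

lemma commutation_mat_nth:
  "commutation_mat $ (a, b) $ (c, d) = (if a = d \<and> b = c then 1 else 0)"
proof -
  have "commutation_mat $ (a, b) $ (c, d) =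
      (\<Sum>i\<in>UNIV. \<Sum>j\<in>UNIV. if i = c then (if j = a then
         (if a = d \<and> b = c then 1 else 0) else 0) else (0::complex))"
    unfolding commutation_mat_def sum_component
    by (intro sum.cong refl) (auto simp: kron_def unit_mat_def)
  also have "\<dots> = (\<Sum>i\<in>UNIV. if i = c then (if a = d \<and> b = c then 1 else 0) else 0)"
    by (intro sum.cong refl) (auto simp: sum.delta)
  also have "\<dots> = (if a = d \<and> b = c then 1 else 0)"
    by (simp add: sum.delta)
  finally show ?thesis .
qed

lemma vec_mat_transpose: "vec_mat (transpose X) = commutation_mat *v vec_mat X"
proof -
  have "(commutation_mat *v vec_mat X) $ (a, b) = vec_mat (transpose X) $ (a, b)" for a b
  proof -
    have "(commutation_mat *v vec_mat X) $ (a, b) =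
        (\<Sum>q\<in>UNIV. if q = (b, a) then X $ a $ b else 0)"
      unfolding matrix_vector_mult_def vec_lambda_beta
      by (intro sum.cong refl)
        (auto simp: commutation_mat_nth vec_mat_def split: prod.splits if_splits)
    also have "\<dots> = X $ a $ b"
      by (simp only: sum.delta finite if_True UNIV_I)
    finally show ?thesis
      by (simp add: vec_mat_def transpose_def)
  qed
  then show ?thesis
    by (simp add: vec_eq_iff)
qed

text \<open>The differential of \<open>g\<close> at \<open>X\<close> is the real-linear map
  \<open>H \<mapsto> P vec H + Q vec H\<^sup>*\<close>.\<close>

definition has_unpatterned_derivs ::
  "(complex^'n^'n \<Rightarrow> complex) \<Rightarrow> complex^'n^'n \<Rightarrow>
     complex^('n \<times> 'n)^1 \<Rightarrow> complex^('n \<times> 'n)^1 \<Rightarrow> bool" where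
  "has_unpatterned_derivs g X P Q \<longleftrightarrow>
     (g has_derivative (\<lambda>H. (P *v vec_mat H + Q *v vec_mat (conj_mat H)) $ 1)) (at X)"

definition deriv_mat :: "(complex^'n^'n \<Rightarrow> complex) \<Rightarrow> complex^'n^'n \<Rightarrow> complex^('n \<times> 'n)^1" where
  "deriv_mat g X = (THE P. \<exists>Q. has_unpatterned_derivs g X P Q)"

definition deriv_conj_mat ::
  "(complex^'n^'n \<Rightarrow> complex) \<Rightarrow> complex^'n^'n \<Rightarrow> complex^('n \<times> 'n)^1" where
  "deriv_conj_mat g X = (THE Q. \<exists>P. has_unpatterned_derivs g X P Q)"

lemma has_unpatterned_derivs_unique:
  fixes X :: "complex^'n^'n"
  assumes "has_unpatterned_derivs g X P Q" "has_unpatterned_derivs g X P' Q'"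
  shows "P = P' \<and> Q = Q'"
proof -
  have eq: "(P *v vec_mat H + Q *v vec_mat (conj_mat H)) $ 1 =
      (P' *v vec_mat H + Q' *v vec_mat (conj_mat H)) $ 1" for H
    using has_derivative_unique[OF assms[unfolded has_unpatterned_derivs_def]] by meson
  have val: "(R *v vec_mat (\<chi> i j. if i = b \<and> j = a then z else 0)) $ 1 = R $ 1 $ (a, b) * z"
    for R :: "complex^('n \<times> 'n)^1" and a b :: 'n and z
  proof -
    have "(R *v vec_mat (\<chi> i j. if i = b \<and> j = a then z else 0)) $ 1 =
        (\<Sum>q\<in>UNIV. if q = (a, b) then R $ 1 $ (a, b) * z else 0)"
      unfolding matrix_vector_mult_def vec_lambda_beta
      by (intro sum.cong refl) (auto simp: vec_mat_def split: prod.splits)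
    also have "\<dots> = R $ 1 $ (a, b) * z"
      by (simp only: sum.delta finite if_True UNIV_I)
    finally show ?thesis .
  qed
  have conj: "conj_mat (\<chi> i j. if i = b \<and> j = a then z else 0) =
      (\<chi> i j. if i = b \<and> j = a then cnj z else 0)" for a b :: 'n and z
    by (simp add: conj_mat_def map_matrix_def vec_eq_iff)
  have *: "P $ 1 $ (a, b) * z + Q $ 1 $ (a, b) * cnj z =
      P' $ 1 $ (a, b) * z + Q' $ 1 $ (a, b) * cnj z" for a b z
    using eq[of "\<chi> i j. if i = b \<and> j = a then z else 0"] by (simp add: val conj)
  have "P $ 1 $ (a, b) = P' $ 1 $ (a, b) \<and> Q $ 1 $ (a, b) = Q' $ 1 $ (a, b)" for a b
  proof -
    have 1: "P $ 1 $ (a, b) + Q $ 1 $ (a, b) = P' $ 1 $ (a, b) + Q' $ 1 $ (a, b)"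
      using *[of a b 1] by simp
    have "\<i> * (P $ 1 $ (a, b) - Q $ 1 $ (a, b)) = \<i> * (P' $ 1 $ (a, b) - Q' $ 1 $ (a, b))"
      using *[of a b \<i>] by (simp add: algebra_simps)
    then have 2: "P $ 1 $ (a, b) - Q $ 1 $ (a, b) = P' $ 1 $ (a, b) - Q' $ 1 $ (a, b)"
      by simp
    have "2 * P $ 1 $ (a, b) = 2 * P' $ 1 $ (a, b)"
      using arg_cong2[OF 1 2, of "(+)"] by (simp add: algebra_simps)
    with 1 show ?thesis by simp
  qed
  then show ?thesis
    by (simp add: vec_eq_iff forall_1)
qed

lemma deriv_mat_eqI:
  assumes "has_unpatterned_derivs g X P Q"
  shows "deriv_mat g X = P" "deriv_conj_mat g X = Q"
  unfolding deriv_mat_def deriv_conj_mat_def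
  using assms has_unpatterned_derivs_unique by blast+

definition hermitian_deriv ::
  "(complex^'n^'n \<Rightarrow> complex) \<Rightarrow> complex^'n^'n \<Rightarrow> complex^('n \<times> 'n)^1" where
  "hermitian_deriv g A = deriv_mat g A + deriv_conj_mat g A ** commutation_mat"

end

theory Submission
  imports Defs
begin

text \<open>
  Near \<open>A\<close> the map \<open>X \<mapsto> abs_mat X\<close> is the composition of \<open>X \<mapsto> dagger X ** X\<close> with a local
  inverse of squaring at \<open>P = abs_mat A\<close>: the Sylvester equation \<open>P ** G + G ** P = 0\<close> has only the
  trivial solution for positive definite \<open>P\<close>, so the inverse function theorem applies. The
  derivative \<open>G\<close> of \<open>abs_mat\<close> in direction \<open>H\<close> satisfies
  \<open>P ** G + G ** P = dagger A ** H + dagger H ** A\<close>; multiplying by the inverse of \<open>P\<close> and taking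
  traces gives \<open>2 trace G = trace (S ** H) + trace (S ** dagger H)\<close> where \<open>S\<close> is the sign of \<open>A\<close>.
\<close>

section \<open>Matrix algebra\<close>

lemma dagger_nth: "dagger X $ i $ j = cnj (X $ j $ i)"
  by (simp add: dagger_def conj_mat_def transpose_def map_matrix_def)

lemma dagger_dagger [simp]: "dagger (dagger X) = X"
  by (simp add: vec_eq_iff dagger_nth)

lemma dagger_mult: "dagger (X ** Y) = dagger Y ** dagger X"
  by (simp add: vec_eq_iff dagger_nth matrix_matrix_mult_def mult.commute)

lemma bounded_linear_dagger: "bounded_linear (dagger :: complex^'n^'m \<Rightarrow> complex^'m^'n)"
  unfolding linear_conv_bounded_linear[symmetric]
  by (rule linearI) (simp_all add: vec_eq_iff dagger_nth)

lemma bilinear_matrix_mult: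
  "bilinear ((**) :: complex^'n^'m \<Rightarrow> complex^'p^'n \<Rightarrow> complex^'p^'m)"
  unfolding bilinear_def
  by (intro conjI allI linearI)
    (simp_all only: vec_eq_iff matrix_matrix_mult_def vec_lambda_beta vector_add_component
      vector_scaleR_component distrib_left distrib_right sum.distrib scaleR_sum_right
      mult_scaleR_left mult_scaleR_right simp_thms)

lemma bounded_bilinear_matrix_mult:
  "bounded_bilinear ((**) :: complex^'n^'m \<Rightarrow> complex^'p^'n \<Rightarrow> complex^'p^'m)"
  using bilinear_matrix_mult bilinear_conv_bounded_bilinear by blast

lemma bounded_bilinear_matrix_vector_mult:
  "bounded_bilinear ((*v) :: complex^'n^'m \<Rightarrow> complex^'n \<Rightarrow> complex^'m)"
proof -
  have "bilinear ((*v) :: complex^'n^'m \<Rightarrow> complex^'n \<Rightarrow> complex^'m)"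
    unfolding bilinear_def
    by (auto intro!: linearI simp: vec_eq_iff matrix_vector_mult_def sum.distrib distrib_left distrib_right
        scaleR_sum_right)
  then show ?thesis
    using bilinear_conv_bounded_bilinear by blast
qed

lemmas matrix_mult_add_left = bounded_bilinear.add_left[OF bounded_bilinear_matrix_mult]
lemmas matrix_mult_add_right = bounded_bilinear.add_right[OF bounded_bilinear_matrix_mult]
lemmas matrix_mult_diff_left = bounded_bilinear.diff_left[OF bounded_bilinear_matrix_mult]
lemmas matrix_mult_diff_right = bounded_bilinear.diff_right[OF bounded_bilinear_matrix_mult]
lemmas matrix_mult_scaleR_left = bounded_bilinear.scaleR_left[OF bounded_bilinear_matrix_mult]
lemmas matrix_mult_scaleR_right = bounded_bilinear.scaleR_right[OF bounded_bilinear_matrix_mult]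

lemma bounded_linear_trace: "bounded_linear (trace :: complex^'n^'n \<Rightarrow> complex)"
proof -
  have "linear (trace :: complex^'n^'n \<Rightarrow> complex)"
    by (rule linearI) (simp_all add: trace_def sum.distrib scaleR_sum_right)
  then show ?thesis
    by (simp add: linear_conv_bounded_linear)
qed

lemma matrix_inv_eqI:
  fixes X Y :: "complex^'n^'n"
  assumes "X ** Y = mat 1" "Y ** X = mat 1"
  shows "matrix_inv X = Y"
proof -
  have "X ** matrix_inv X = mat 1 \<and> matrix_inv X ** X = mat 1"
    unfolding matrix_inv_def by (rule someI[of _ Y]) (use assms in simp)
  then show ?thesis
    by (metis assms(2) matrix_mul_assoc matrix_mul_lid matrix_mul_rid)
qed

section \<open>Diagonal matrices and their unitary conjugates\<close>

definition diag_mat :: "('n \<Rightarrow> complex) \<Rightarrow> complex^'n^'n" where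
  "diag_mat d = (\<chi> i j. if i = j then d i else 0)"

lemma diag_mat_vector: "(diag_mat d *v v) $ i = d i * v $ i"
proof -
  have "(diag_mat d *v v) $ i = (\<Sum>j\<in>UNIV. if i = j then d i * v $ j else 0)"
    unfolding diag_mat_def matrix_vector_mult_def vec_lambda_beta
    by (intro sum.cong refl) auto
  then show ?thesis by simp
qed

lemma diag_mat_mult: "diag_mat a ** diag_mat b = diag_mat (\<lambda>i. a i * b i)"
proof -
  have "(diag_mat a ** diag_mat b) $ i $ j = diag_mat (\<lambda>i. a i * b i) $ i $ j" for i j
    using diag_mat_vector[of a "column j (diag_mat b)" i]
    by (simp add: matrix_matrix_mult_def matrix_vector_mult_def column_def) (simp add: diag_mat_def)
  then show ?thesis by (simp add: vec_eq_iff)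
qed

lemma dagger_diag_mat: "dagger (diag_mat d) = diag_mat (\<lambda>i. cnj (d i))"
  by (auto simp: vec_eq_iff diag_mat_def dagger_nth)

lemma diag_mat_one: "diag_mat (\<lambda>i. 1) = mat 1"
  by (simp add: diag_mat_def mat_def)

text \<open>The inner factor \<open>dagger U ** U\<close> cancels. This makes unitary conjugation of
  diagonal matrices a functional calculus.\<close>

lemma conjugate_diag_mult:
  assumes "unitary U"
  shows "(U ** diag_mat a ** dagger U) ** (U ** diag_mat b ** dagger U) =
    U ** diag_mat (\<lambda>i. a i * b i) ** dagger U"
proof -
  have "(U ** diag_mat a ** dagger U) ** (U ** diag_mat b ** dagger U) =
      U ** diag_mat a ** (dagger U ** U) ** diag_mat b ** dagger U"
    by (simp add: matrix_mul_assoc)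
  also have "\<dots> = U ** (diag_mat a ** diag_mat b) ** dagger U"
    using assms by (simp add: unitary_def matrix_mul_assoc)
  finally show ?thesis
    by (simp add: diag_mat_mult)
qed

section \<open>Accretive matrices and uniqueness of square roots\<close>

text \<open>The library's real inner product on complex vectors is the real part of the Hermitian
  form, so positivity can be treated with the inner product lemmas.\<close>

lemma inner_cnj_sum: "v \<bullet> w = Re (\<Sum>i\<in>UNIV. cnj (v $ i) * w $ i)"
  by (simp add: inner_vec_def inner_complex_def)

lemma pos_semidef_iff: "pos_semidef X \<longleftrightarrow> hermitian X \<and> (\<forall>v. 0 \<le> v \<bullet> (X *v v))"
  by (simp add: pos_semidef_def inner_cnj_sum)

lemma inner_matrix_vector_dagger: "(X *v v) \<bullet> w = v \<bullet> (dagger X *v w)"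
proof -
  have "(\<Sum>i\<in>UNIV. cnj ((X *v v) $ i) * w $ i) =
      (\<Sum>i\<in>UNIV. \<Sum>j\<in>UNIV. cnj (X $ i $ j) * cnj (v $ j) * w $ i)"
    by (simp add: matrix_vector_mult_def sum_distrib_right)
  also have "\<dots> = (\<Sum>j\<in>UNIV. \<Sum>i\<in>UNIV. cnj (X $ i $ j) * cnj (v $ j) * w $ i)"
    by (rule sum.swap)
  also have "\<dots> = (\<Sum>j\<in>UNIV. cnj (v $ j) * (dagger X *v w) $ j)"
    by (simp add: matrix_vector_mult_def sum_distrib_left dagger_nth mult_ac)
  finally show ?thesis
    by (simp add: inner_cnj_sum)
qed

lemma inner_matrix_mult_left:
  fixes Q D :: "complex^'n^'n"
  shows "D \<bullet> (Q ** D) = (\<Sum>j\<in>UNIV. column j D \<bullet> (Q *v column j D))"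
proof -
  have "D \<bullet> (Q ** D) = (\<Sum>i\<in>UNIV. \<Sum>j\<in>UNIV. D $ i $ j \<bullet> (Q ** D) $ i $ j)"
    by (simp add: inner_vec_def)
  also have "\<dots> = (\<Sum>j\<in>UNIV. \<Sum>i\<in>UNIV. D $ i $ j \<bullet> (Q ** D) $ i $ j)"
    by (rule sum.swap)
  finally show ?thesis
    by (simp add: inner_vec_def column_def matrix_matrix_mult_def matrix_vector_mult_def)
qed

text \<open>Right multiplication acts on rows; conjugating row \<open>i\<close> of \<open>D\<close>
  gives column \<open>i\<close> of \<open>dagger D\<close>, on which \<open>Q\<close> acts from the
  left. With the column version this carries positivity on vectors over to matrices.\<close>

lemma inner_matrix_mult_right:
  fixes Q D :: "complex^'n^'n"
  shows "D \<bullet> (D ** Q) = (\<Sum>i\<in>UNIV. column i (dagger D) \<bullet> (Q *v column i (dagger D)))"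
proof -
  have "D $ i \<bullet> (D ** Q) $ i = column i (dagger D) \<bullet> (Q *v column i (dagger D))" for i
  proof -
    have "(\<Sum>k\<in>UNIV. cnj (D $ i $ k) * (D ** Q) $ i $ k) =
        (\<Sum>k\<in>UNIV. \<Sum>l\<in>UNIV. cnj (D $ i $ k) * (D $ i $ l * Q $ l $ k))"
      by (simp add: matrix_matrix_mult_def sum_distrib_left)
    also have "\<dots> = (\<Sum>l\<in>UNIV. \<Sum>k\<in>UNIV. cnj (D $ i $ k) * (D $ i $ l * Q $ l $ k))"
      by (rule sum.swap)
    also have "\<dots> = (\<Sum>l\<in>UNIV. cnj (column i (dagger D) $ l) * (Q *v column i (dagger D)) $ l)"
      by (simp add: matrix_vector_mult_def sum_distrib_left dagger_nth column_def mult_ac)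
    finally show ?thesis
      by (simp add: inner_cnj_sum)
  qed
  then show ?thesis
    by (simp add: inner_vec_def[of D])
qed

text \<open>Pairing the equation with \<open>D\<close> gives two nonnegative terms of sum zero.
  Strictness for \<open>Q\<close> then kills every column of \<open>D\<close>.\<close>

lemma sylvester_zero:
  fixes D :: "complex^'n^'n"
  assumes "Q ** D + D ** R = 0"
    and Q: "\<And>v. v \<noteq> 0 \<Longrightarrow> 0 < v \<bullet> (Q *v v)" and R: "\<And>v. 0 \<le> v \<bullet> (R *v v)"
  shows "D = 0"
proof -
  have Q0: "0 \<le> v \<bullet> (Q *v v)" for v
    using Q[of v] by (cases "v = 0") auto
  have "D \<bullet> (Q ** D) + D \<bullet> (D ** R) = 0"
    using assms(1) by (simp flip: inner_add_right)
  moreover have "0 \<le> D \<bullet> (D ** R)"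
    unfolding inner_matrix_mult_right by (intro sum_nonneg R)
  moreover have "0 \<le> D \<bullet> (Q ** D)"
    unfolding inner_matrix_mult_left by (intro sum_nonneg Q0)
  ultimately have "(\<Sum>j\<in>UNIV. column j D \<bullet> (Q *v column j D)) = 0"
    unfolding inner_matrix_mult_left by linarith
  then have "column j D \<bullet> (Q *v column j D) = 0" for j
    using Q0 by (simp add: sum_nonneg_eq_0_iff)
  then have "column j D = 0" for j
    using Q by (metis less_irrefl)
  then show ?thesis
    by (simp add: vec_eq_iff column_def)
qed

text \<open>The difference \<open>Q - R\<close> solves a Sylvester equation. Positivity is stated
  only through the inner product, so that the lemma applies to roots not yet known to be
  Hermitian.\<close>

lemma square_root_unique:
  fixes Q R :: "complex^'n^'n"
  assumes "Q ** Q = R ** R"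
    and "\<And>v. v \<noteq> 0 \<Longrightarrow> 0 < v \<bullet> (Q *v v)" and "\<And>v. 0 \<le> v \<bullet> (R *v v)"
  shows "Q = R"
proof -
  have "Q ** (Q - R) + (Q - R) ** R = 0"
    using assms(1) by (simp add: matrix_mult_diff_left matrix_mult_diff_right)
  then have "Q - R = 0"
    using sylvester_zero assms(2,3) by blast
  then show ?thesis by simp
qed

lemma sqrt_mat_eqI:
  assumes "hermitian Q" "\<And>v. v \<noteq> 0 \<Longrightarrow> 0 < v \<bullet> (Q *v v)" "Q ** Q = M"
  shows "sqrt_mat M = Q"
  unfolding sqrt_mat_def
proof (rule the_equality)
  have "0 \<le> v \<bullet> (Q *v v)" for v
    using assms(2)[of v] by (cases "v = 0") auto
  then show "pos_semidef Q \<and> Q ** Q = M"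
    using assms by (simp add: pos_semidef_iff)
next
  fix R assume "pos_semidef R \<and> R ** R = M"
  then show "R = Q"
    using square_root_unique[of Q R] assms(2,3) by (auto simp: pos_semidef_iff)
qed

text \<open>Replacing \<open>P\<close> by \<open>Q\<close> changes the quadratic form by at most
  \<open>norm (P - Q) * K * (v \<bullet> v)\<close>, which stays below the margin
  \<open>c * (v \<bullet> v)\<close> within distance \<open>c / K\<close>.\<close>

lemma accretive_near:
  fixes P :: "complex^'n^'n"
  assumes "0 < c" and P: "\<And>v. c * (v \<bullet> v) \<le> v \<bullet> (P *v v)"
  obtains e where "0 < e" "\<And>Q v. dist P Q < e \<Longrightarrow> v \<noteq> 0 \<Longrightarrow> 0 < v \<bullet> (Q *v v)"
proof -
  obtain K where K: "0 < K" "\<And>(X::complex^'n^'n) v. norm (X *v v) \<le> norm X * norm v * K"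
    using bounded_bilinear.pos_bounded[OF bounded_bilinear_matrix_vector_mult] by blast
  have "0 < v \<bullet> (Q *v v)" if d: "dist P Q < c / K" and "v \<noteq> 0" for Q v
  proof -
    have "\<bar>v \<bullet> ((P - Q) *v v)\<bar> \<le> norm v * (norm (P - Q) * norm v * K)"
      by (rule order_trans[OF Cauchy_Schwarz_ineq2]) (intro mult_left_mono K norm_ge_zero)
    also have "\<dots> = norm (P - Q) * K * (v \<bullet> v)"
      by (simp add: power2_norm_eq_inner[symmetric] power2_eq_square)
    also have "\<dots> < c * (v \<bullet> v)"
      using d \<open>0 < K\<close> \<open>v \<noteq> 0\<close> by (intro mult_strict_right_mono) (auto simp: dist_norm field_simps)
    finally have "v \<bullet> ((P - Q) *v v) < c * (v \<bullet> v)"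
      by linarith
    then show ?thesis
      using P[of v] by (simp add: matrix_vector_mult_diff_rdistrib inner_diff_right)
  qed
  then show ?thesis
    using that[of "c / K"] \<open>0 < K\<close> \<open>0 < c\<close> by simp
qed

text \<open>Conjugation and transposition preserve the Frobenius norm. Hence \<open>dagger\<close>
  maps a ball around a Hermitian matrix to itself.\<close>

lemma dist_dagger: "dist (dagger X) (dagger Y) = dist X (Y :: complex^'n^'n)"
proof -
  have "dagger X \<bullet> dagger X = X \<bullet> X" for X :: "complex^'n^'n"
    unfolding inner_vec_def by (subst sum.swap) (simp add: dagger_nth inner_complex_def)
  then have "norm (dagger (X - Y)) = norm (X - Y)"
    by (simp add: norm_eq_sqrt_inner)
  then show ?thesis
    by (simp add: dist_norm linear_diff[OF bounded_linear.linear[OF bounded_linear_dagger]])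
qed

section \<open>The local square root and the derivative of the absolute value\<close>

text \<open>The differential of squaring, packaged as a bounded linear function because the inverse
  function theorem takes derivatives in that type.\<close>

definition anticommute :: "complex^'n^'n \<Rightarrow> (complex^'n^'n) \<Rightarrow>\<^sub>L (complex^'n^'n)" where
  "anticommute Q = Blinfun (\<lambda>H. Q ** H + H ** Q)"

lemma anticommute_apply [simp]: "anticommute Q H = Q ** H + H ** Q"
  unfolding anticommute_def
  by (subst bounded_linear_Blinfun_apply)
    (intro bounded_linear_add bounded_bilinear.bounded_linear_left
      bounded_bilinear.bounded_linear_right bounded_bilinear_matrix_mult refl)+

lemma continuous_on_anticommute: "continuous_on S anticommute"
proof -
  have "linear (anticommute :: complex^'n^'n \<Rightarrow> _)"
    by (intro linearI blinfun_eqI)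
      (simp_all add: plus_blinfun.rep_eq scaleR_blinfun.rep_eq matrix_mult_add_left
        matrix_mult_add_right matrix_mult_scaleR_left matrix_mult_scaleR_right scaleR_add_right)
  then show ?thesis
    unfolding linear_conv_bounded_linear by (rule linear_continuous_on)
qed

lemma has_derivative_square:
  "((\<lambda>Q. Q ** Q) has_derivative anticommute Q) (at (Q :: complex^'n^'n))"
proof -
  have "((\<lambda>Q. Q ** Q) has_derivative (\<lambda>H. Q ** H + H ** Q)) (at Q)"
    by (rule bounded_bilinear.FDERIV[OF bounded_bilinear_matrix_mult]) (rule has_derivative_ident)+
  moreover have "blinfun_apply (anticommute Q) = (\<lambda>H. Q ** H + H ** Q)"
    by auto
  ultimately show ?thesis by simp
qed

text \<open>A matrix with a positive semidefinite root is Hermitian, so \<open>sqrt_mat\<close> is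
  meaningful on no full neighbourhood of \<open>P ** P\<close>. The derivative is therefore that of
  a local inverse \<open>g\<close> of squaring, which agrees with \<open>sqrt_mat\<close> on
  Hermitian matrices.\<close>

lemma local_sqrt_mat:
  fixes P :: "complex^'n^'n"
  assumes "hermitian P" "0 < c" and P: "\<And>v. c * (v \<bullet> v) \<le> v \<bullet> (P *v v)"
  obtains V L where "open V" "P ** P \<in> V"
    "\<And>H. P ** L H + L H ** P = H"
    "\<exists>g. (g has_derivative L) (at (P ** P)) \<and> (\<forall>M\<in>V. hermitian M \<longrightarrow> sqrt_mat M = g M)"
proof -
  obtain e where "0 < e"
    and e: "\<And>Q v. dist P Q < e \<Longrightarrow> v \<noteq> 0 \<Longrightarrow> 0 < v \<bullet> (Q *v v)"
    using accretive_near[OF \<open>0 < c\<close> P] by blast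
  have P0: "0 < v \<bullet> (P *v v)" if "v \<noteq> 0" for v
    using e[of P v] \<open>0 < e\<close> that by simp
  have nonneg: "0 \<le> v \<bullet> (Q *v v)" if "dist P Q < e" for Q v
    using e[OF that, of v] by (cases "v = 0") auto
  have lin: "linear (blinfun_apply (anticommute P))"
    by (simp add: blinfun.bounded_linear_right bounded_linear.linear)
  have "inj (blinfun_apply (anticommute P))"
    unfolding linear_injective_0[OF lin]
  proof (intro allI impI)
    fix D assume "anticommute P D = 0"
    then have "P ** D + D ** P = 0" by simp
    then show "D = 0"
      by (rule sylvester_zero) (use P0 nonneg[of P] \<open>0 < e\<close> in simp_all)
  qed
  \<comment> \<open>The theorem wants a bounded left inverse of the derivative; in finite dimension
    injectivity provides one.\<close>
  then obtain h where h: "linear h" "h \<circ> blinfun_apply (anticommute P) = id"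
    using linear_injective_left_inverse[OF lin] by blast
  have inv: "Blinfun h o\<^sub>L anticommute P = id_blinfun"
  proof (rule blinfun_eqI)
    fix H
    show "(Blinfun h o\<^sub>L anticommute P) H = id_blinfun H"
      using fun_cong[OF h(2), of H] h(1)
      by (simp add: bounded_linear_Blinfun_apply linear_conv_bounded_linear)
  qed
  have "P \<in> ball P e"
    using \<open>0 < e\<close> by simp
  then obtain U V g g' where "open U" "U \<subseteq> ball P e" "P \<in> U" "open V"
    and PV: "P ** P \<in> V" and hom: "homeomorphism U V (\<lambda>Q. Q ** Q) g"
    and g': "\<And>M. M \<in> V \<Longrightarrow> (g has_derivative g' M) (at M)"
    "\<And>M. M \<in> V \<Longrightarrow> g' M = Hilbert_Choice.inv (blinfun_apply (anticommute (g M)))"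
    "\<And>M. M \<in> V \<Longrightarrow> bij (blinfun_apply (anticommute (g M)))"
    by (rule inverse_function_theorem[OF open_ball has_derivative_square
          continuous_on_anticommute _ inv]) blast
  have gP: "g (P ** P) = P"
    using hom \<open>P \<in> U\<close> by (simp add: homeomorphism_def)
  define L where "L = g' (P ** P)"
  have "anticommute P (L H) = H" for H
    unfolding L_def g'(2)[OF PV] gP
    using bij_is_surj[OF g'(3)[OF PV]] unfolding gP by (rule surj_f_inv_f)
  then have L: "P ** L H + L H ** P = H" for H
    by simp
  have sqrt: "sqrt_mat M = g M" if "M \<in> V" "hermitian M" for M
  proof (rule sqrt_mat_eqI)
    have "g M \<in> U" and sq: "g M ** g M = M"
      using hom that by (auto simp: homeomorphism_def)
    then have near: "dist P (g M) < e"
      using \<open>U \<subseteq> ball P e\<close> by auto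
    \<comment> \<open>The matrix \<open>dagger (g M)\<close> is another root of \<open>M\<close> in
      the same ball, so uniqueness makes \<open>g M\<close> Hermitian.\<close>
    have "dist P (dagger (g M)) < e"
      using near dist_dagger[of P "g M"] \<open>hermitian P\<close> by (simp add: hermitian_def)
    moreover have "dagger (g M) ** dagger (g M) = M"
      using sq \<open>hermitian M\<close> by (simp add: hermitian_def flip: dagger_mult)
    ultimately have "g M = dagger (g M)"
      using square_root_unique[of "g M" "dagger (g M)"] e[OF near] nonneg sq by simp
    then show "hermitian (g M)"
      by (simp add: hermitian_def)
    show "g M ** g M = M" "\<And>v. v \<noteq> 0 \<Longrightarrow> 0 < v \<bullet> (g M *v v)"
      using sq e[OF near] by auto
  qed
  show ?thesis
    using that[OF \<open>open V\<close> PV L] g'(1)[OF PV] sqrt unfolding L_def by blast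
qed

lemma has_derivative_abs_mat:
  fixes A :: "complex^'n^'n"
  assumes "hermitian P" "0 < c" "\<And>v. c * (v \<bullet> v) \<le> v \<bullet> (P *v v)" "P ** P = dagger A ** A"
  obtains L where "(abs_mat has_derivative L) (at A)"
    "\<And>H. P ** L H + L H ** P = dagger A ** H + dagger H ** A"
proof -
  obtain V L g where V: "open V" "P ** P \<in> V" and L: "\<And>H. P ** L H + L H ** P = H"
    and g: "(g has_derivative L) (at (P ** P))" "\<And>M. M \<in> V \<Longrightarrow> hermitian M \<Longrightarrow> sqrt_mat M = g M"
    using local_sqrt_mat[OF assms(1-3)] by metis
  have gram: "((\<lambda>X. dagger X ** X) has_derivative (\<lambda>H. dagger A ** H + dagger H ** A)) (at A)"
    by (rule bounded_bilinear.FDERIV[OF bounded_bilinear_matrix_mult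
          bounded_linear_imp_has_derivative[OF bounded_linear_dagger] has_derivative_ident])
  have "((\<lambda>X. g (dagger X ** X)) has_derivative (\<lambda>H. L (dagger A ** H + dagger H ** A))) (at A)"
    by (rule has_derivative_compose[OF gram]) (use g(1) assms(4) in simp)
  \<comment> \<open>Gram matrices are Hermitian, so \<open>g\<close> computes \<open>abs_mat\<close>
    wherever \<open>dagger X ** X\<close> lies in \<open>V\<close>.\<close>
  moreover have "eventually (\<lambda>X. g (dagger X ** X) = abs_mat X) (at A)"
  proof -
    have "isCont (\<lambda>X. dagger X ** X) A"
      using gram by (rule has_derivative_continuous)
    then have "eventually (\<lambda>X. dagger X ** X \<in> V) (at A)"
      using V assms(4) by (auto simp: isCont_def intro: topological_tendstoD)
    then show ?thesis
      by eventually_elim (simp add: abs_mat_def g(2) hermitian_def dagger_mult)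
  qed
  moreover have "g (dagger A ** A) = abs_mat A"
    using g(2)[of "P ** P"] V(2) assms(4)
    by (simp add: abs_mat_def hermitian_def dagger_mult)
  ultimately have "(abs_mat has_derivative (\<lambda>H. L (dagger A ** H + dagger H ** A))) (at A)"
    by (rule has_derivative_transform_eventually) simp
  then show ?thesis
    using that L by blast
qed

section \<open>The derivative of the trace norm\<close>

lemma vecT_nth: "vecT X $ 1 $ (a, b) = X $ b $ a"
  by (simp add: vecT_def rowvector_def vec_mat_def)

lemma vecT_mult_vec_mat: "(vecT X *v vec_mat Y) $ 1 = trace (transpose X ** Y)"
proof -
  have "(vecT X *v vec_mat Y) $ 1 = (\<Sum>(a, b)\<in>UNIV \<times> UNIV. X $ b $ a * Y $ b $ a)"
    by (auto simp: matrix_vector_mult_def vecT_def rowvector_def vec_mat_def intro!: sum.cong)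
  also have "\<dots> = (\<Sum>a\<in>UNIV. \<Sum>b\<in>UNIV. X $ b $ a * Y $ b $ a)"
    by (rule sum.cartesian_product[symmetric])
  finally show ?thesis
    by (simp add: trace_def matrix_matrix_mult_def transpose_def)
qed

lemma vecT_commutation_mat: "vecT X ** commutation_mat = vecT (transpose X)"
proof -
  have "(vecT X ** commutation_mat) $ 1 $ (c, d) = vecT (transpose X) $ 1 $ (c, d)" for c d
  proof -
    have "(vecT X ** commutation_mat) $ 1 $ (c, d) =
        (\<Sum>q\<in>UNIV. if q = (d, c) then X $ c $ d else 0)"
      unfolding matrix_matrix_mult_def vec_lambda_beta
      by (intro sum.cong refl)
        (auto simp: commutation_mat_nth vecT_nth split: prod.splits if_splits)
    also have "\<dots> = X $ c $ d"
      by (simp only: sum.delta finite if_True UNIV_I)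
    finally show ?thesis
      by (simp add: vecT_nth transpose_def)
  qed
  then show ?thesis
    by (simp add: vec_eq_iff forall_1)
qed

lemma trace_mult_commute: "trace (X ** Y) = trace (Y ** (X :: complex^'n^'n))"
  unfolding trace_def matrix_matrix_mult_def
  by (simp add: mult.commute) (rule sum.swap)

text \<open>Here \<open>P\<close> stands for the absolute value of \<open>A\<close>,
  \<open>R\<close> for its inverse and \<open>S\<close> for the sign of \<open>A\<close>. They enter
  only through their algebraic relations, which keeps the eigendecomposition out of the
  differentiation.\<close>

lemma trace_norm_unpatterned_derivs:
  fixes A :: "complex^'n^'n"
  assumes "hermitian A" "hermitian P" "0 < c" "\<And>v. c * (v \<bullet> v) \<le> v \<bullet> (P *v v)"
    and "P ** P = A ** A"
    and "R ** P = mat 1" "P ** R = mat 1" "R ** A = S" "A ** R = S"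
  shows "has_unpatterned_derivs trace_norm A
    ((1 / 2) *\<^sub>R vecT (transpose S)) ((1 / 2) *\<^sub>R vecT S)"
proof -
  have A: "dagger A = A"
    using \<open>hermitian A\<close> by (simp add: hermitian_def)
  obtain L where L: "(abs_mat has_derivative L) (at A)"
    and eq: "\<And>H. P ** L H + L H ** P = dagger A ** H + dagger H ** A"
    using has_derivative_abs_mat[OF assms(2-4), of A] assms(5) A by auto
  have tr_add: "trace (X + Y) = trace X + trace Y" for X Y :: "complex^'n^'n"
    by (rule linear_add[OF bounded_linear.linear[OF bounded_linear_trace]])
  have tr: "2 * trace (L H) = trace (S ** H) + trace (S ** dagger H)" for H
  proof -
    \<comment> \<open>After multiplication by \<open>R\<close>, cyclicity of the trace turns both
      terms on the left into \<open>trace (L H)\<close>.\<close>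
    have "trace (R ** (P ** L H)) + trace (R ** (L H ** P)) =
        trace (R ** (A ** H)) + trace (R ** (dagger H ** A))"
      using arg_cong[OF eq, of "\<lambda>X. trace (R ** X)" H]
      by (simp add: A matrix_mult_add_right tr_add)
    moreover have "R ** (P ** L H) = L H" "R ** (A ** H) = S ** H"
      using assms by (simp_all add: matrix_mul_assoc)
    moreover have "trace (R ** (L H ** P)) = trace (L H)"
      using trace_mult_commute[of "R ** L H" P] assms(7) by (simp add: matrix_mul_assoc)
    moreover have "trace (R ** (dagger H ** A)) = trace (S ** dagger H)"
      using trace_mult_commute[of "R ** dagger H" A] assms(9) by (simp add: matrix_mul_assoc)
    ultimately show ?thesis
      by simp
  qed
  have "(((1 / 2) *\<^sub>R vecT (transpose S)) *v vec_mat H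
      + ((1 / 2) *\<^sub>R vecT S) *v vec_mat (conj_mat H)) $ 1 = trace (L H)" for H
  proof -
    \<comment> \<open>Transposing inside the trace turns the conjugate of \<open>H\<close> into its
      adjoint.\<close>
    have "trace (transpose S ** conj_mat H) = trace (transpose (transpose S ** conj_mat H))"
      by (simp add: trace_def transpose_def)
    also have "\<dots> = trace (S ** dagger H)"
      by (simp add: matrix_transpose_mul dagger_def trace_mult_commute)
    finally have "trace (transpose S ** conj_mat H) = trace (S ** dagger H)" .
    then have "(((1 / 2) *\<^sub>R vecT (transpose S)) *v vec_mat H
        + ((1 / 2) *\<^sub>R vecT S) *v vec_mat (conj_mat H)) $ 1 =
        (1 / 2) *\<^sub>R (trace (S ** H) + trace (S ** dagger H))"
      by (simp add: bounded_bilinear.scaleR_left[OF bounded_bilinear_matrix_vector_mult]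
          vecT_mult_vec_mat scaleR_add_right)
    also have "\<dots> = trace (L H)"
      unfolding tr[symmetric] by (simp add: scaleR_conv_of_real)
    finally show ?thesis .
  qed
  moreover have "(trace_norm has_derivative (\<lambda>H. trace (L H))) (at A)"
    unfolding trace_norm_def using bounded_linear.has_derivative[OF bounded_linear_trace L] .
  ultimately show ?thesis
    by (simp add: has_unpatterned_derivs_def)
qed

section \<open>Spectral evaluation of the derivative\<close>

theorem mainTheorem3:
  fixes A U \<Lambda> :: "complex^'n^'n"
  assumes "invertible A" and "hermitian A"
    and "unitary U" and "real_diagonal \<Lambda>" and "A = U ** \<Lambda> ** dagger U"
  shows "trace_norm differentiable (at A)
    \<and> hermitian_deriv trace_norm A = vecT (transpose A ** transpose (matrix_inv (abs_mat A)))
    \<and> hermitian_deriv trace_norm A = vecT (A ** matrix_inv (abs_mat A)) ** commutation_mat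
    \<and> hermitian_deriv trace_norm A = vecT (conj_mat U ** sign_mat \<Lambda> ** transpose U)"
proof -
  define l where "l i = Re (\<Lambda> $ i $ i)" for i
  have \<Lambda>: "\<Lambda> = diag_mat (\<lambda>i. of_real (l i))"
    using \<open>real_diagonal \<Lambda>\<close> by (auto simp: vec_eq_iff diag_mat_def real_diagonal_def l_def)
  have sign: "sign_mat \<Lambda> = diag_mat (\<lambda>i. of_real (sgn (l i)))"
    by (simp add: sign_mat_def diag_mat_def l_def)
  have "det A \<noteq> 0"
    using \<open>invertible A\<close> by (simp add: invertible_det_nz)
  then have "det \<Lambda> \<noteq> 0"
    by (auto simp: assms(5) det_mul)
  moreover have "det \<Lambda> = (\<Prod>i\<in>UNIV. \<Lambda> $ i $ i)"
    by (rule det_diagonal) (use \<open>real_diagonal \<Lambda>\<close> in \<open>simp add: real_diagonal_def\<close>)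
  ultimately have l: "l i \<noteq> 0" for i
    by (auto simp: \<Lambda> diag_mat_def)
  \<comment> \<open>\<open>E d\<close> has the eigenvectors of \<open>A\<close> and the eigenvalues
    \<open>d\<close>; absolute value, inverse and sign become pointwise operations on
    \<open>l\<close>.\<close>
  define E :: "('n \<Rightarrow> real) \<Rightarrow> complex^'n^'n" where
    "E d = U ** diag_mat (\<lambda>i. of_real (d i)) ** dagger U" for d
  have E_mult: "E a ** E b = E (\<lambda>i. a i * b i)" for a b
    using conjugate_diag_mult[OF \<open>unitary U\<close>] by (simp add: E_def)
  have E_one: "E (\<lambda>i. 1) = mat 1"
    using \<open>unitary U\<close> by (simp add: E_def diag_mat_one unitary_def)
  have E_herm: "hermitian (E d)" for d
    by (simp add: E_def hermitian_def dagger_mult dagger_diag_mat matrix_mul_assoc)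
  have A: "A = E l"
    by (simp add: E_def assms(5) \<Lambda>)
  define P where "P = E (\<lambda>i. \<bar>l i\<bar>)"
  define R where "R = E (\<lambda>i. 1 / \<bar>l i\<bar>)"
  define S where "S = E (\<lambda>i. sgn (l i))"
  have RP: "R ** P = mat 1" "P ** R = mat 1"
    using l by (simp_all add: R_def P_def E_mult E_one)
  have PP: "P ** P = A ** A"
    by (simp add: A P_def E_mult)
  have sgn_l: "1 / \<bar>l i\<bar> * l i = sgn (l i)" "l i * (1 / \<bar>l i\<bar>) = sgn (l i)" for i
    by (simp_all add: sgn_real_def l abs_if)
  have RA: "R ** A = S" "A ** R = S"
    by (simp_all only: A R_def S_def E_mult sgn_l)
  \<comment> \<open>The smallest absolute eigenvalue: positive since there are finitely many, all
    nonzero. It bounds the quadratic form of \<open>P\<close> from below.\<close>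
  define c where "c = Min (range (\<lambda>i. \<bar>l i\<bar>))"
  have c: "0 < c" "\<And>i. c \<le> \<bar>l i\<bar>"
    using l by (auto simp: c_def)
  have P: "c * (v \<bullet> v) \<le> v \<bullet> (P *v v)" for v
  proof -
    \<comment> \<open>Coordinates of \<open>v\<close> in the eigenbasis, where the form of
      \<open>P\<close> is a weighted sum of squares.\<close>
    define w where "w = dagger U *v v"
    have "v \<bullet> v = w \<bullet> w"
      using \<open>unitary U\<close> inner_matrix_vector_dagger[of "dagger U" v w]
      by (simp add: w_def unitary_def matrix_vector_mul_assoc)
    then have "c * (v \<bullet> v) = (\<Sum>i\<in>UNIV. c * (w $ i \<bullet> w $ i))"
      by (simp add: inner_vec_def sum_distrib_left)
    also have "\<dots> \<le> (\<Sum>i\<in>UNIV. \<bar>l i\<bar> * (w $ i \<bullet> w $ i))"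
      by (intro sum_mono mult_right_mono c inner_ge_zero)
    also have "\<dots> = w \<bullet> (diag_mat (\<lambda>i. of_real \<bar>l i\<bar>) *v w)"
      by (simp add: inner_vec_def[of w] diag_mat_vector inner_complex_def algebra_simps)
    also have "\<dots> = v \<bullet> (P *v v)"
      using inner_matrix_vector_dagger[of "dagger U" v]
      by (simp add: w_def P_def E_def matrix_vector_mul_assoc matrix_mul_assoc)
    finally show ?thesis .
  qed
  have abs: "abs_mat A = P"
    unfolding abs_mat_def
  proof (rule sqrt_mat_eqI)
    show "hermitian P" "P ** P = dagger A ** A"
      using PP E_herm \<open>hermitian A\<close> by (auto simp: P_def hermitian_def)
    show "0 < v \<bullet> (P *v v)" if "v \<noteq> 0" for v
      using P[of v] c(1) that by (meson inner_gt_zero_iff less_le_trans mult_pos_pos)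
  qed
  then have inv: "matrix_inv (abs_mat A) = R"
    using RP by (simp add: matrix_inv_eqI)
  have D: "has_unpatterned_derivs trace_norm A
      ((1 / 2) *\<^sub>R vecT (transpose S)) ((1 / 2) *\<^sub>R vecT S)"
    using trace_norm_unpatterned_derivs[OF \<open>hermitian A\<close> _ c(1) P PP RP RA] E_herm
    by (simp add: P_def)
  then have "trace_norm differentiable (at A)"
    unfolding has_unpatterned_derivs_def differentiable_def by blast
  \<comment> \<open>The commutation matrix transposes the second half, so the two halves add
    up.\<close>
  moreover have "hermitian_deriv trace_norm A = vecT (transpose S)"
    unfolding hermitian_deriv_def deriv_mat_eqI[OF D]
    by (simp add: matrix_mult_scaleR_left vecT_commutation_mat flip: scaleR_add_left)
  moreover have "transpose A ** transpose (matrix_inv (abs_mat A)) = transpose S"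
    by (simp add: inv RA flip: matrix_transpose_mul)
  moreover have "vecT (A ** matrix_inv (abs_mat A)) ** commutation_mat = vecT (transpose S)"
    by (simp add: inv RA vecT_commutation_mat)
  \<comment> \<open>Transposition reverses the factors of \<open>S\<close>, fixes the diagonal one
    and turns \<open>dagger U\<close> into \<open>conj_mat U\<close>.\<close>
  moreover have "conj_mat U ** sign_mat \<Lambda> ** transpose U = transpose S"
  proof -
    have "transpose (diag_mat d) = diag_mat d" for d :: "'n \<Rightarrow> complex"
      by (auto simp: vec_eq_iff transpose_def diag_mat_def)
    then show ?thesis
      by (simp add: S_def E_def sign matrix_transpose_mul dagger_def matrix_mul_assoc)
  qed
  ultimately show ?thesis by simp
qed

end
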